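(* Let $(X,d)$ be a relatively compact metric space, let $F=\{f_n\}_{n\in\mathbb N}$ be a time varying bi-measurable map on $X$, and let $\mu$ be a Borel measure on $X$ that is persistent with respect to $F$. Suppose that $F$ can be approximated by time varying bi-measurable maps which are transitive with respect to $\mu$, that is, for every $\delta>0$ there is a time varying bi-measurable map $G=\{g_n\}_{n\in\mathbb N}$ on $X$ with $p(F,G)<\delta$ which is transitive with respect to $\mu$. Then $\Omega(F)=X$.
   Context: $\mathbb N$ denotes the non-negative integers. A metric space is called relatively compact here if its closed bounded subsets are compact. A bi-measurable map is a Borel measurable bijection with Borel measurable inverse. A time varying bi-measurable map on $X$ is a family $F=\{f_n\}_{n\in\mathbb N}$ of bi-measurable maps $f_n:X\to X$ with $f_0=\mathrm{id}_X$. Put $F_n=f_n\circ\cdots\circ f_1\circ f_0$ for $n\ge 0$ and $F_n=f_{-n}^{-1}\circ f_{-(n-1)}^{-1}\circ\cdots\circ f_1^{-1}\circ f_0^{-1}$ for $n<0$ (and similarly $G_n$ for $G=\{g_n\}$). For $i\le j$ put $F_{[i,j]}=f_j\circ f_{j-1}\circ\cdots\circ f_{i+1}\circ f_i$ and $F_{[i,j]}^{-1}=f_j^{-1}\circ f_{j-1}^{-1}\circ\cdots\circ f_{i+1}^{-1}\circ f_i^{-1}$. Let $d_1(x,y)=\min\{d(x,y),1\}$, $\eta(f,g)=\sup_{x\in X}d_1(f(x),g(x))$, and $p(F,G)=\max\{\sup_{n\in\mathbb N}\eta(f_n,g_n),\ \sup_{n\in\mathbb N}\eta(f_n^{-1},g_n^{-1})\}$.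 $\mu$ is persistent with respect to $F$ if for every $\epsilon>0$ there are $0<\delta<1$ and a measurable set $B\subset X$ with $\mu(X\setminus B)=0$ such that for every time varying bi-measurable map $G$ with $p(F,G)<\delta$ and every $x\in B$ there is $y\in X$ with $d(F_n(y),G_n(x))<\epsilon$ for all $n\in\mathbb Z$. $\omega(F,x)$ is the set of $y\in X$ with $\lim_{k\to\infty}d(F_{n_k}(x),y)=0$ for some strictly increasing sequence of integers $(n_k)$. $F$ is transitive with respect to $\mu$ if the set of transitive points (points $x$ with $\omega(F,x)=X$) has positive $\mu$-measure. A point $x\in X$ is non-wandering for $F$ if for every open set $U$ containing $x$ and every $n\ge 0$ there are $m\ge n$ and $r\ge 0$ such that $F_{[m,m+r]}(U)\cap U\neq\emptyset$ or $F^{-1}_{[m,m+r]}(U)\cap U\ne\emptyset$. $\Omega(F)$ is the set of non-wandering points. *)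

theory Defs
  imports "HOL-Analysis.Analysis"
begin

definition bi_measurable :: "('a::metric_space \<Rightarrow> 'a) \<Rightarrow> bool" where
  "bi_measurable f \<longleftrightarrow> bij f \<and> f \<in> borel_measurable borel \<and> inv f \<in> borel_measurable borel"

definition time_varying_bi_measurable :: "(nat \<Rightarrow> 'a::metric_space \<Rightarrow> 'a) \<Rightarrow> bool" where
  "time_varying_bi_measurable f \<longleftrightarrow> f 0 = id \<and> (\<forall>n. bi_measurable (f n))"

text \<open>
  For \<open>i \<le> j\<close>, \<open>comp_interval f i j\<close> is \<open>f j \<circ> f (j - 1) \<circ> \<dots> \<circ> f (i + 1) \<circ> f i\<close>
  (and the identity if \<open>j < i\<close>).  With \<open>f\<close> and \<open>\<lambda>n. inv (f n)\<close> it gives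
  \<open>F\<^bsub>[i,j]\<^esub>\<close> and \<open>F\<^bsub>[i,j]\<^esub>\<close> with exponent \<open>-1\<close>.  In the latter the inverses are composed in
  the same order of indices, so it is in general not the inverse map of the former.
\<close>

definition comp_interval :: "(nat \<Rightarrow> 'a \<Rightarrow> 'a) \<Rightarrow> nat \<Rightarrow> nat \<Rightarrow> 'a \<Rightarrow> 'a" where
  "comp_interval f i j = fold (\<lambda>k h. f k \<circ> h) [i..<Suc j] id"

definition iter_map :: "(nat \<Rightarrow> 'a \<Rightarrow> 'a) \<Rightarrow> int \<Rightarrow> 'a \<Rightarrow> 'a" where
  "iter_map f n = (if n \<ge> 0 then comp_interval f 0 (nat n)
                   else comp_interval (\<lambda>k. inv (f k)) 0 (nat (- n)))"

text \<open>
  The suprema below are over nonempty sets of reals in the interval from 0 to 1,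
  so the conditionally complete \<open>SUP\<close> on the reals is the genuine supremum.
\<close>

definition dist1 :: "'a::metric_space \<Rightarrow> 'a \<Rightarrow> real" where
  "dist1 x y = min (dist x y) 1"

definition map_dist :: "('a::metric_space \<Rightarrow> 'a) \<Rightarrow> ('a \<Rightarrow> 'a) \<Rightarrow> real" where
  "map_dist f g = (SUP x. dist1 (f x) (g x))"

definition family_dist :: "(nat \<Rightarrow> 'a::metric_space \<Rightarrow> 'a) \<Rightarrow> (nat \<Rightarrow> 'a \<Rightarrow> 'a) \<Rightarrow> real" where
  "family_dist f g = max (SUP n. map_dist (f n) (g n)) (SUP n. map_dist (inv (f n)) (inv (g n)))"

definition persistent :: "'a::metric_space measure \<Rightarrow> (nat \<Rightarrow> 'a \<Rightarrow> 'a) \<Rightarrow> bool" where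
  "persistent \<mu> f \<longleftrightarrow>
    (\<forall>\<epsilon>>0. \<exists>\<delta> B. 0 < \<delta> \<and> \<delta> < 1 \<and> B \<in> sets \<mu> \<and> emeasure \<mu> (space \<mu> - B) = 0 \<and>
      (\<forall>g. time_varying_bi_measurable g \<and> family_dist f g < \<delta> \<longrightarrow>
        (\<forall>x\<in>B. \<exists>y. \<forall>n::int. dist (iter_map f n y) (iter_map g n x) < \<epsilon>)))"

definition omega_limit :: "(nat \<Rightarrow> 'a::metric_space \<Rightarrow> 'a) \<Rightarrow> 'a \<Rightarrow> 'a set" where
  "omega_limit f x =
    {y. \<exists>n :: nat \<Rightarrow> int. strict_mono n \<and> (\<lambda>k. dist (iter_map f (n k) x) y) \<longlonglongrightarrow> 0}"

text \<open>
  \<open>emeasure\<close> is 0 on non-measurable sets, so the set of transitive points is implicitly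
  required to be measurable; on a separable space (in particular, on one whose closed bounded
  sets are compact) this is automatic for time varying bi-measurable maps and Borel measures.
\<close>

definition transitive_wrt :: "'a::metric_space measure \<Rightarrow> (nat \<Rightarrow> 'a \<Rightarrow> 'a) \<Rightarrow> bool" where
  "transitive_wrt \<mu> f \<longleftrightarrow> emeasure \<mu> {x. omega_limit f x = UNIV} > 0"

definition non_wandering :: "(nat \<Rightarrow> 'a::metric_space \<Rightarrow> 'a) \<Rightarrow> 'a set" where
  "non_wandering f =
    {x. \<forall>U. open U \<and> x \<in> U \<longrightarrow>
      (\<forall>n. \<exists>m\<ge>n. \<exists>r.
        comp_interval f m (m + r) ` U \<inter> U \<noteq> {} \<or>
        comp_interval (\<lambda>k. inv (f k)) m (m + r) ` U \<inter> U \<noteq> {})}"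

end

theory Submission
  imports Defs
begin

text \<open>
  A transitive point \<open>z\<close> of a small perturbation \<open>G\<close> that lies in the full-measure set given by
  persistence returns to every neighbourhood of \<open>x\<close> at arbitrarily large times.  The \<open>F\<close>-orbit of
  some \<open>y\<close> follows the \<open>G\<close>-orbit of \<open>z\<close>, so it visits a neighbourhood \<open>U\<close> of \<open>x\<close> at two times
  \<open>a < b\<close> beyond any given bound, and \<open>F\<^bsub>[a+1,b]\<^esub>\<close> maps the first visit to the second.
\<close>

text \<open>The initial value of the fold is applied first, so it factors out on the right; a split
  of the index list thereby becomes a split of the composition.\<close>

lemma fold_comp_eq_comp:
  fixes f :: "'b \<Rightarrow> 'a \<Rightarrow> 'a" and g :: "'a \<Rightarrow> 'a"
  shows "fold (\<lambda>k h. f k \<circ> h) ks g = fold (\<lambda>k h. f k \<circ> h) ks id \<circ> g"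
proof (induction ks arbitrary: g)
  case Nil
  show ?case by simp
next
  case (Cons k ks)
  show ?case
    using Cons.IH[of "f k \<circ> g"] Cons.IH[of "f k"] by (simp add: comp_assoc)
qed

lemma comp_interval_split:
  assumes "i \<le> Suc a" "a \<le> b"
  shows "comp_interval f i b = comp_interval f (Suc a) b \<circ> comp_interval f i a"
proof -
  have "[i..<Suc b] = [i..<Suc a] @ [Suc a..<Suc b]"
    using upt_add_eq_append[OF assms(1), of "b - a"] assms(2) by simp
  then show ?thesis
    unfolding comp_interval_def by (simp add: fold_comp_eq_comp[symmetric] del: upt_Suc)
qed

lemma strict_mono_int_add_le:
  fixes n :: "nat \<Rightarrow> int"
  assumes "strict_mono n"
  shows "n 0 + int k \<le> n k"
proof (induction k)
  case (Suc k)
  have "n k < n (Suc k)" using assms by (simp add: strict_mono_less)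
  with Suc show ?case by simp
qed simp

text \<open>The times may start out negative, but a strictly increasing integer sequence is
  unbounded above, so a limit point is always approached along the forward orbit.\<close>

lemma omega_limit_visit:
  assumes "x \<in> omega_limit g z" "0 < \<epsilon>"
  shows "\<exists>m\<ge>N. dist (iter_map g (int m) z) x < \<epsilon>"
proof -
  obtain n where n: "strict_mono n" "(\<lambda>k. dist (iter_map g (n k) z) x) \<longlonglongrightarrow> 0"
    using assms(1) unfolding omega_limit_def by blast
  obtain K where K: "\<And>k. k \<ge> K \<Longrightarrow> dist (iter_map g (n k) z) x < \<epsilon>"
    using order_tendstoD(2)[OF n(2) assms(2)] unfolding eventually_sequentially by blast
  \<comment> \<open>The first bound gives closeness to \<open>x\<close>; the second gives
    \<open>n k \<ge> int N\<close>, because \<open>n k \<ge> n 0 + int k\<close>.\<close>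
  define k where "k = max K (nat (int N - n 0))"
  have "int N \<le> n k"
    using strict_mono_int_add_le[OF n(1), of k] unfolding k_def by linarith
  moreover have "dist (iter_map g (n k) z) x < \<epsilon>"
    by (rule K) (simp add: k_def)
  ultimately show ?thesis
    by (intro exI[of _ "nat (n k)"]) auto
qed

text \<open>\<open>emeasure\<close> is 0 on non-measurable sets, so positivity makes the set of
  transitive points measurable; by monotonicity it cannot lie in the null complement of
  \<open>B\<close>.\<close>

lemma full_measure_meets_transitive_points:
  assumes "B \<in> sets \<mu>" "emeasure \<mu> (space \<mu> - B) = 0" "transitive_wrt \<mu> g"
  obtains z where "z \<in> B" "omega_limit g z = UNIV"
proof -
  let ?T = "{x. omega_limit g x = UNIV}"
  have pos: "emeasure \<mu> ?T \<noteq> 0"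
    using assms(3) unfolding transitive_wrt_def by simp
  then have "?T \<in> sets \<mu>"
    using emeasure_notin_sets[of ?T \<mu>] by argo
  then have "?T \<subseteq> space \<mu>"
    by (rule sets.sets_into_space)
  moreover have "\<not> ?T \<subseteq> space \<mu> - B"
    using emeasure_mono[of ?T "space \<mu> - B" \<mu>] assms(1,2) pos by auto
  ultimately show thesis using that by blast
qed

theorem theorem5p10:
  fixes f :: "nat \<Rightarrow> 'a::metric_space \<Rightarrow> 'a" and \<mu> :: "'a measure"
  assumes "\<forall>S::'a set. closed S \<and> bounded S \<longrightarrow> compact S"
    and "time_varying_bi_measurable f"
    and "sets \<mu> = sets borel"
    and "persistent \<mu> f"
    and "\<forall>\<delta>>0. \<exists>g. time_varying_bi_measurable g \<and> family_dist f g < \<delta> \<and> transitive_wrt \<mu> g"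
  shows "non_wandering f = UNIV"
proof -
  have "\<exists>m\<ge>N. \<exists>r. comp_interval f m (m + r) ` U \<inter> U \<noteq> {}"
    if U: "open U" "x \<in> U" for x :: 'a and U N
  proof -
    obtain e where e: "e > 0" "ball x e \<subseteq> U"
      using U open_contains_ball by blast
    \<comment> \<open>One half of \<open>e\<close> bounds the tracing error, the other the distance
      from \<open>x\<close> to the visiting point of the \<open>g\<close>-orbit of
      \<open>z\<close>.\<close>
    then have e2: "e / 2 > 0" by simp
    obtain \<delta> B where "\<delta> > 0" and B: "B \<in> sets \<mu>" "emeasure \<mu> (space \<mu> - B) = 0"
      and trace: "\<And>g z. \<lbrakk>time_varying_bi_measurable g; family_dist f g < \<delta>; z \<in> B\<rbrakk> \<Longrightarrow>
        \<exists>y. \<forall>n::int. dist (iter_map f n y) (iter_map g n z) < e / 2"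
      using assms(4)[unfolded persistent_def, rule_format, OF e2] by metis
    obtain g where g: "time_varying_bi_measurable g" "family_dist f g < \<delta>" "transitive_wrt \<mu> g"
      using assms(5) \<open>\<delta> > 0\<close> by blast
    obtain z where z: "z \<in> B" "omega_limit g z = UNIV"
      using full_measure_meets_transitive_points[OF B g(3)] .
    obtain y where y: "\<And>n::int. dist (iter_map f n y) (iter_map g n z) < e / 2"
      using trace[OF g(1,2) z(1)] by blast
    have visit: "\<exists>m\<ge>M. comp_interval f 0 m y \<in> U" for M
    proof -
      obtain m where m: "m \<ge> M" "dist (iter_map g (int m) z) x < e / 2"
        using omega_limit_visit[OF _ e2] z(2) by blast
      have "dist x (iter_map f (int m) y) < e"
        using dist_triangle_half_l[of x "iter_map g (int m) z" e] m(2) y[of "int m"]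
        by (metis dist_commute)
      with e(2) m(1) show ?thesis
        by (auto simp: iter_map_def)
    qed
    obtain a where a: "a \<ge> N" "comp_interval f 0 a y \<in> U" using visit by blast
    \<comment> \<open>Asking for \<open>b \<ge> Suc a\<close> makes the block from
      \<open>Suc a\<close> to \<open>b\<close> non-empty, so that \<open>m = Suc a\<close> and
      \<open>r = b - Suc a\<close> give \<open>m + r = b\<close>.\<close>
    obtain b where b: "b \<ge> Suc a" "comp_interval f 0 b y \<in> U" using visit by blast
    have "comp_interval f (Suc a) b (comp_interval f 0 a y) \<in> U"
      using comp_interval_split[of 0 a b f] b by simp
    with a b(1) show ?thesis
      by (intro exI[of _ "Suc a"] exI[of _ "b - Suc a"] conjI) auto
  qed
  then have "x \<in> non_wandering f" for x
    unfolding non_wandering_def mem_Collect_eq by metis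
  then show ?thesis by auto
qed

end
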